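(* Let $\mathcal{X}\subset\mathbb{R}^n$ be a compact convex set, let $f$ be convex (possibly nonsmooth), let $x^*\in\operatorname{argmin}_{x\in\mathcal{X}}f(x)$, let $R>0$ be such that $\mathcal{X}\subset B(x^*,R)$, and let $L>0$ be such that for every $x\in\mathcal{X}$ the subdifferential $\partial f(x)$ is nonempty and $\|g\|\le L$ for every $g\in\partial f(x)$. Let $(x_s)_{s\ge1}$ be any sequence of iterates of the projected subgradient method started at a point $x_1\in\mathcal{X}$ with step-sizes $\eta_s=\frac{R}{L\sqrt{s}}$, $s\ge1$. Then for every fixed real number $k>-1$, $$f\left(\frac{\sum_{s=1}^t \frac{1}{\eta_s^k}x_s}{\sum_{s=1}^t \frac{1}{\eta_s^k}}\right)-f(x^* )=\mathcal{O}\left(\frac{1}{\sqrt{t}}\right),$$ i.e. there is a constant $C$ independent of $t$ such that the left-hand side is at most $C/\sqrt{t}$ for all integers $t\ge1$.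
   Context: $\|\cdot\|$ is the Euclidean norm on $\mathbb{R}^n$ and $B(x^*,R)$ is the closed Euclidean ball of radius $R$ centered at $x^*$. The function $f$ is a real-valued convex function defined on a convex set $D\subset\mathbb{R}^n$ containing $\mathcal{X}$ (e.g. $D=\mathbb{R}^n$), and $\partial f(x)=\{g\in\mathbb{R}^n: f(y)\ge f(x)+g^T(y-x)\ \text{for all } y\in D\}$ is its subdifferential at $x$. The projected subgradient method with positive step-sizes $(\eta_s)_{s\ge1}$, started at $x_1\in\mathcal{X}$, generates, for $s\ge1$, $$y_{s+1}=x_s-\eta_s g_s,\quad\text{where } g_s\in\partial f(x_s)\text{ is arbitrary},\qquad x_{s+1}=\operatorname{argmin}_{x\in\mathcal{X}}\|x-y_{s+1}\|.$$ Here $\eta_s^k$ denotes the $k$-th power of $\eta_s$. *)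

theory Defs
  imports "HOL-Analysis.Analysis"
begin

text \<open>A function on \<open>D\<close> is represented by a total function; only its values on \<open>D\<close> matter.\<close>

definition subdifferential ::
  "(real ^ 'n) set \<Rightarrow> (real ^ 'n \<Rightarrow> real) \<Rightarrow> real ^ 'n \<Rightarrow> (real ^ 'n) set" where
  "subdifferential D f x = {g. \<forall>y\<in>D. f y \<ge> f x + g \<bullet> (y - x)}"

text \<open>Iterates are indexed from 1: the values \<open>x 0\<close>, \<open>y 0\<close>, \<open>y 1\<close>, \<open>g 0\<close> and \<open>\<eta> 0\<close> play no role.\<close>

definition projected_subgradient_method ::
  "(real ^ 'n) set \<Rightarrow> (real ^ 'n \<Rightarrow> real) \<Rightarrow> (real ^ 'n) set \<Rightarrow> (nat \<Rightarrow> real) \<Rightarrow>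
   (nat \<Rightarrow> real ^ 'n) \<Rightarrow> (nat \<Rightarrow> real ^ 'n) \<Rightarrow> (nat \<Rightarrow> real ^ 'n) \<Rightarrow> bool" where
  "projected_subgradient_method D f X \<eta> x y g \<longleftrightarrow>
     x 1 \<in> X \<and>
     (\<forall>s\<ge>1. \<eta> s > 0 \<and>
        g s \<in> subdifferential D f (x s) \<and>
        y (s + 1) = x s - \<eta> s *\<^sub>R g s \<and>
        is_arg_min (\<lambda>z. norm (z - y (s + 1))) (\<lambda>z. z \<in> X) (x (s + 1)))"

end

theory Submission
  imports Defs
begin

text \<open>
  Since the projection onto \<open>X\<close> does not increase the distance to \<open>x\<^sup>*\<close>, one step yields
  \<open>2 \<eta>\<^sub>s (f x\<^sub>s - f x\<^sup>*) \<le> d\<^sub>s - d\<^sub>s\<^sub>+\<^sub>1 + \<eta>\<^sub>s\<^sup>2 L\<^sup>2\<close> with \<open>d\<^sub>s = \<parallel>x\<^sub>s - x\<^sup>*\<parallel>\<^sup>2 \<le> R\<^sup>2\<close>.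
  Multiply by \<open>\<eta>\<^sub>s\<close> to the power \<open>-(k+1)\<close>, which is increasing in \<open>s\<close> because \<open>k > -1\<close>, and sum
  by parts: the weighted sum of the gaps is \<open>O(t powr ((k+1)/2))\<close>. The weights add up to at least
  a constant times \<open>t powr (k/2+1)\<close>, so Jensen's inequality bounds the gap at the average by
  \<open>O(1/\<surd>t)\<close>.
\<close>

section \<open>Growth of sums of real powers, and summation by parts\<close>

lemma powr_Suc_diff_mvt:
  fixes b :: real and n :: nat
  assumes "b > 0"
  obtains \<xi> where "real n < \<xi>" "\<xi> < real (Suc n)"
    "real (Suc n) powr b - real n powr b = b * \<xi> powr (b - 1)"
proof -
  \<comment> \<open>At the left endpoint only continuity is used, so \<open>n = 0\<close> is covered
    even where the derivative fails to exist at 0; continuity there comes from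
    \<open>b > 0\<close>.\<close>
  have "continuous_on {real n..real (Suc n)} (\<lambda>x. x powr b)"
    using assms by (intro continuous_on_powr' continuous_intros) auto
  moreover have "((\<lambda>x. x powr b) has_real_derivative b * x powr (b - 1)) (at x)"
    if "real n < x" for x
    using that by (auto intro!: derivative_eq_intros)
  ultimately obtain l z where z: "real n < z" "z < real (Suc n)"
      "((\<lambda>x. x powr b) has_real_derivative l) (at z)"
      "real (Suc n) powr b - real n powr b = (real (Suc n) - real n) * l"
    using MVT[of "real n" "real (Suc n)" "\<lambda>x. x powr b"]
    by (force simp: real_differentiable_def)
  have "((\<lambda>x. x powr b) has_real_derivative b * z powr (b - 1)) (at z)"
    using z(1) by (auto intro!: derivative_eq_intros)
  then have "l = b * z powr (b - 1)"
    using z(3) DERIV_unique by blast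
  then show thesis
    using z that by simp
qed

text \<open>For \<open>a \<ge> 0\<close> every term is at most the last one. For
  \<open>a < 0\<close> the terms decrease, so each is at most the mean-value expression on the unit
  interval to its left, and these telescope. The \<open>max\<close> merges the constants of the two
  cases.\<close>

lemma sum_powr_le:
  fixes a :: real
  assumes "a > -1"
  shows "(\<Sum>s=1..t. real s powr a) \<le> max 1 (1 / (a + 1)) * real t powr (a + 1)"
proof (cases "a \<ge> 0")
  case True
  have "(\<Sum>s=1..t. real s powr a) \<le> (\<Sum>s=1..t. real t powr a)"
    using True by (intro sum_mono powr_mono2) auto
  also have "\<dots> = 1 * real t powr (a + 1)"
    by (cases "t = 0") (auto simp: powr_add)
  also have "\<dots> \<le> max 1 (1 / (a + 1)) * real t powr (a + 1)"
    by (intro mult_right_mono) auto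
  finally show ?thesis .
next
  case False
  have "(\<Sum>s=1..t. real s powr a) \<le> 1 / (a + 1) * real t powr (a + 1)"
  proof (induction t)
    case (Suc n)
    obtain \<xi> where \<xi>: "real n < \<xi>" "\<xi> < real (Suc n)"
      "real (Suc n) powr (a + 1) - real n powr (a + 1) = (a + 1) * \<xi> powr a"
      using powr_Suc_diff_mvt[of "a + 1" n] assms by auto
    have "real (Suc n) powr a \<le> \<xi> powr a"
      using \<xi> False by (intro powr_mono2') auto
    also have "\<dots> = 1 / (a + 1) * (real (Suc n) powr (a + 1) - real n powr (a + 1))"
      using assms unfolding \<xi>(3) by simp
    finally show ?case
      using Suc by (simp add: algebra_simps del: of_nat_Suc)
  qed simp
  also have "\<dots> \<le> max 1 (1 / (a + 1)) * real t powr (a + 1)"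
    by (intro mult_right_mono) auto
  finally show ?thesis .
qed

text \<open>Mirror image of \<open>sum_powr_le\<close>: for \<open>a \<le> 0\<close> the last term
  is the smallest, and for \<open>a > 0\<close> each term dominates the mean-value expression to its
  left.\<close>

lemma sum_powr_ge:
  fixes a :: real
  assumes "a > -1"
  shows "min 1 (1 / (a + 1)) * real t powr (a + 1) \<le> (\<Sum>s=1..t. real s powr a)"
proof (cases "a \<le> 0")
  case True
  have "min 1 (1 / (a + 1)) * real t powr (a + 1) \<le> 1 * real t powr (a + 1)"
    by (intro mult_right_mono) auto
  also have "\<dots> = (\<Sum>s=1..t. real t powr a)"
    by (cases "t = 0") (auto simp: powr_add)
  also have "\<dots> \<le> (\<Sum>s=1..t. real s powr a)"
    using True by (intro sum_mono powr_mono2') auto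
  finally show ?thesis .
next
  case False
  have "min 1 (1 / (a + 1)) * real t powr (a + 1) \<le> 1 / (a + 1) * real t powr (a + 1)"
    by (intro mult_right_mono) auto
  also have "\<dots> \<le> (\<Sum>s=1..t. real s powr a)"
  proof (induction t)
    case (Suc n)
    obtain \<xi> where \<xi>: "real n < \<xi>" "\<xi> < real (Suc n)"
      "real (Suc n) powr (a + 1) - real n powr (a + 1) = (a + 1) * \<xi> powr a"
      using powr_Suc_diff_mvt[of "a + 1" n] assms by auto
    have "1 / (a + 1) * (real (Suc n) powr (a + 1) - real n powr (a + 1)) = \<xi> powr a"
      using assms unfolding \<xi>(3) by simp
    also have "\<dots> \<le> real (Suc n) powr a"
      using \<xi> False by (intro powr_mono2) auto
    finally show ?case
      using Suc by (simp add: algebra_simps del: of_nat_Suc)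
  qed simp
  finally show ?thesis .
qed

text \<open>After summation by parts, each nonnegative increment of \<open>a\<close> multiplies a
  value of \<open>d\<close> bounded by \<open>M\<close>; together with \<open>a 1 * M\<close> the
  increments collapse to \<open>a t * M\<close>.\<close>

lemma sum_mult_diff_le:
  fixes a d :: "nat \<Rightarrow> real"
  assumes "\<And>s. s \<ge> 1 \<Longrightarrow> a s \<le> a (Suc s)" and "\<And>s. s \<ge> 1 \<Longrightarrow> a s \<ge> 0"
    and "\<And>s. s \<ge> 1 \<Longrightarrow> 0 \<le> d s" and "\<And>s. s \<ge> 1 \<Longrightarrow> d s \<le> M"
    and "t \<ge> 1"
  shows "(\<Sum>s=1..t. a s * (d s - d (Suc s))) \<le> a t * M"
proof -
  \<comment> \<open>The term with \<open>d (Suc t)\<close> is kept to make the induction close: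
    since \<open>M - d (Suc n)\<close> is nonnegative, its coefficient may be raised from
    \<open>a n\<close> to \<open>a (Suc n)\<close>.\<close>
  have "(\<Sum>s=1..t. a s * (d s - d (Suc s))) \<le> a t * (M - d (Suc t))"
    using \<open>t \<ge> 1\<close>
  proof (induction t rule: dec_induct)
    case base
    then show ?case
      using assms(2)[of 1] assms(4)[of 1] by (simp add: mult_left_mono)
  next
    case (step n)
    have "a n * (M - d (Suc n)) \<le> a (Suc n) * (M - d (Suc n))"
      using assms(1)[of n] assms(4)[of "Suc n"] step.hyps by (intro mult_right_mono) auto
    then show ?case
      using step by (simp add: algebra_simps)
  qed
  also have "\<dots> \<le> a t * M"
    using assms(2,3) \<open>t \<ge> 1\<close> by (intro mult_left_mono) auto
  finally show ?thesis .
qed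

section \<open>Projection, the one-step inequality and Jensen's inequality\<close>

text \<open>At the projection \<open>p\<close> the directions to \<open>v\<close> and to any
  \<open>u\<close> in \<open>X\<close> form an angle of at least 90 degrees, so the cross term in
  the expansion of the squared distance has a favourable sign.\<close>

lemma norm_closest_point_le:
  fixes X :: "'a::euclidean_space set"
  assumes "convex X" "closed X" "u \<in> X" "is_arg_min (\<lambda>z. norm (z - v)) (\<lambda>z. z \<in> X) p"
  shows "norm (p - u) \<le> norm (v - u)"
proof -
  have p: "p \<in> X" "\<forall>z\<in>X. dist v p \<le> dist v z"
    using assms(4) by (auto simp: is_arg_min_linorder dist_norm norm_minus_commute)
  have "(v - p) \<bullet> (u - p) \<le> 0"
    using any_closest_point_dot[OF assms(1,2) p(1) assms(3) p(2)] .
  moreover have "(norm (v - u))\<^sup>2 = (norm (v - p))\<^sup>2 + (norm (p - u))\<^sup>2 - 2 * ((v - p) \<bullet> (u - p))"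
    by (simp add: power2_norm_eq_inner algebra_simps inner_commute)
  ultimately have "(norm (p - u))\<^sup>2 \<le> (norm (v - u))\<^sup>2"
    using zero_le_power2[of "norm (v - p)"] by linarith
  then show ?thesis
    by (rule power2_le_imp_le) simp
qed

text \<open>Expanding the squared distance from the unprojected point to \<open>u\<close> produces
  the linear term \<open>h \<bullet> (z - u)\<close>, which the subgradient inequality tested at
  \<open>u\<close> bounds below by the gap; projecting does not increase the distance.\<close>

lemma projected_subgradient_step:
  assumes "convex X" "closed X" "u \<in> X" "u \<in> D" "h \<in> subdifferential D f z" "norm h \<le> L" "e \<ge> 0"
    and "is_arg_min (\<lambda>w. norm (w - (z - e *\<^sub>R h))) (\<lambda>w. w \<in> X) p"
  shows "2 * e * (f z - f u) \<le> (norm (z - u))\<^sup>2 - (norm (p - u))\<^sup>2 + e\<^sup>2 * L\<^sup>2"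
proof -
  have "f z - f u \<le> h \<bullet> (z - u)"
    using assms(4,5) by (auto simp: subdifferential_def inner_diff_right)
  then have "2 * e * (f z - f u) \<le> 2 * e * (h \<bullet> (z - u))"
    using \<open>e \<ge> 0\<close> by (intro mult_left_mono) auto
  moreover have "(norm (p - u))\<^sup>2 \<le> (norm (z - e *\<^sub>R h - u))\<^sup>2"
    using norm_closest_point_le[OF assms(1,2,3,8)] by (simp add: power_mono)
  moreover have "(norm (z - e *\<^sub>R h - u))\<^sup>2 = (norm (z - u))\<^sup>2 - 2 * e * (h \<bullet> (z - u)) + e\<^sup>2 * (norm h)\<^sup>2"
    unfolding power2_norm_eq_inner by (simp add: algebra_simps inner_commute power2_eq_square)
  moreover have "e\<^sup>2 * (norm h)\<^sup>2 \<le> e\<^sup>2 * L\<^sup>2"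
    using assms(6) by (intro mult_left_mono power_mono) auto
  ultimately show ?thesis by linarith
qed

text \<open>Jensen's inequality for the weights divided by their sum. As these add up to 1, the
  constant \<open>c\<close> can be subtracted inside each term.\<close>

lemma convex_on_weighted_mean_le:
  fixes f :: "'a::real_vector \<Rightarrow> real" and w :: "'i \<Rightarrow> real"
  assumes "convex_on D f" "finite I" "\<And>i. i \<in> I \<Longrightarrow> w i \<ge> 0" "(\<Sum>i\<in>I. w i) > 0"
    and "\<And>i. i \<in> I \<Longrightarrow> z i \<in> D"
  shows "f ((1 / (\<Sum>i\<in>I. w i)) *\<^sub>R (\<Sum>i\<in>I. w i *\<^sub>R z i)) - c
    \<le> (\<Sum>i\<in>I. w i * (f (z i) - c)) / (\<Sum>i\<in>I. w i)"
proof -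
  let ?W = "\<Sum>i\<in>I. w i"
  have "I \<noteq> {}" using assms(4) by auto
  have "f (\<Sum>i\<in>I. (w i / ?W) *\<^sub>R z i) \<le> (\<Sum>i\<in>I. (w i / ?W) * f (z i))"
    using assms \<open>I \<noteq> {}\<close>
    by (intro convex_on_sum[where C = D]) (auto simp flip: sum_divide_distrib)
  moreover have "(\<Sum>i\<in>I. (w i / ?W) *\<^sub>R z i) = (1 / ?W) *\<^sub>R (\<Sum>i\<in>I. w i *\<^sub>R z i)"
    by (simp add: scaleR_sum_right)
  moreover have "(\<Sum>i\<in>I. (w i / ?W) * f (z i)) - c = (\<Sum>i\<in>I. w i * (f (z i) - c)) / ?W"
    using assms(4)
    by (simp add: right_diff_distrib sum_subtractf diff_divide_distrib sum_divide_distrib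
        flip: sum_distrib_right)
  ultimately show ?thesis by simp
qed

theorem mainTheorem3:
  fixes X D :: "(real ^ 'n) set"
    and f :: "real ^ 'n \<Rightarrow> real"
    and xstar :: "real ^ 'n"
    and R L k :: real
    and \<eta> :: "nat \<Rightarrow> real"
    and x y g :: "nat \<Rightarrow> real ^ 'n"
  assumes "compact X" and "convex X"
    and "convex D" and "X \<subseteq> D" and "convex_on D f"
    and "is_arg_min f (\<lambda>z. z \<in> X) xstar"
    and "R > 0" and "X \<subseteq> cball xstar R"
    and "L > 0"
    and "\<And>z. z \<in> X \<Longrightarrow> subdifferential D f z \<noteq> {}"
    and "\<And>z h. z \<in> X \<Longrightarrow> h \<in> subdifferential D f z \<Longrightarrow> norm h \<le> L"
    and "\<And>s. s \<ge> 1 \<Longrightarrow> \<eta> s = R / (L * sqrt (real s))"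
    and "projected_subgradient_method D f X \<eta> x y g"
    and "k > -1"
  shows "\<exists>C. \<forall>t::nat. t \<ge> 1 \<longrightarrow>
           f ((1 / (\<Sum>s=1..t. 1 / (\<eta> s powr k))) *\<^sub>R (\<Sum>s=1..t. (1 / (\<eta> s powr k)) *\<^sub>R x s))
             - f xstar \<le> C / sqrt (real t)"
proof -
  \<comment> \<open>With this \<open>c\<close>, the step-size is \<open>1 / (c * sqrt s)\<close>.
    \<open>A\<close> and \<open>B\<close> are the constants of \<open>sum_powr_le\<close> at
    exponent \<open>(k - 1) / 2\<close> and \<open>sum_powr_ge\<close> at \<open>k / 2\<close>. The
    two summands of \<open>N\<close> come from the distance terms and from the squared
    step-sizes.\<close>
  define c where "c = L / R"
  define w where "w s = 1 / (\<eta> s powr k)" for s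
  define d where "d s = (norm (x s - xstar))\<^sup>2" for s
  define A where "A = max 1 (1 / ((k - 1) / 2 + 1))"
  define B where "B = min 1 (1 / (k / 2 + 1))"
  define N where "N = c powr (k + 1) * R\<^sup>2 + L\<^sup>2 * c powr (k - 1) * A"
  have "c > 0" using \<open>R > 0\<close> \<open>L > 0\<close> by (simp add: c_def)
  have "B > 0" using \<open>k > -1\<close> by (simp add: B_def)
  have "closed X" using \<open>compact X\<close> by (rule compact_imp_closed)
  have "xstar \<in> X"
    using \<open>is_arg_min f (\<lambda>z. z \<in> X) xstar\<close> by (auto simp: is_arg_min_linorder)
  have pstep: "x 1 \<in> X" "\<And>s. s \<ge> 1 \<Longrightarrow> g s \<in> subdifferential D f (x s)"
    "\<And>s. s \<ge> 1 \<Longrightarrow>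
      is_arg_min (\<lambda>z. norm (z - (x s - \<eta> s *\<^sub>R g s))) (\<lambda>z. z \<in> X) (x (Suc s))"
    using \<open>projected_subgradient_method D f X \<eta> x y g\<close>
    by (auto simp: projected_subgradient_method_def)
  have xX: "x s \<in> X" if "s \<ge> 1" for s
    using that
  proof (induction s rule: dec_induct)
    case (step n)
    then show ?case using pstep(3)[of n] step.hyps
      by (auto simp: is_arg_min_def)
  qed (use pstep in auto)
  \<comment> \<open>Taken at \<open>p = - k\<close>, \<open>- k - 1\<close> and
    \<open>1 - k\<close>, this turns \<open>w s\<close>, \<open>w s / \<eta> s\<close> and
    \<open>w s * \<eta> s\<close> into powers of \<open>s\<close>.\<close>
  have \<eta>: "\<eta> s powr p = c powr - p * real s powr - (p / 2)"
    and eta_pos: "\<eta> s > 0" if "s \<ge> 1" for s p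
  proof -
    have e: "\<eta> s = c powr -1 * real s powr -(1/2)"
      using that \<open>L > 0\<close> \<open>R > 0\<close> assms(12)[of s]
      by (simp add: c_def powr_minus powr_half_sqrt field_simps)
    show "\<eta> s > 0" using e \<open>c > 0\<close> that by simp
    show "\<eta> s powr p = c powr - p * real s powr - (p / 2)"
      unfolding e by (simp only: powr_mult powr_powr powr_ge_zero) simp
  qed
  have w: "w s = c powr k * real s powr (k / 2)" if "s \<ge> 1" for s
  proof -
    have "w s = \<eta> s powr - k" by (simp only: w_def powr_minus_divide)
    then show ?thesis using \<eta>[OF that, of "- k"] by simp
  qed
  have w_div: "w s / \<eta> s = c powr (k + 1) * real s powr ((k + 1) / 2)" if "s \<ge> 1" for s
  proof -
    have "w s / \<eta> s = \<eta> s powr (- k - 1)"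
      using eta_pos[OF that] by (simp only: w_def powr_minus_divide powr_diff powr_one less_imp_le)
    moreover have "- (- k - 1) = k + 1" "- ((- k - 1) / 2) = (k + 1) / 2"
      by (simp_all add: field_simps)
    ultimately show ?thesis using \<eta>[OF that, of "- k - 1"] by (simp only:)
  qed
  have w_mult: "w s * \<eta> s = c powr (k - 1) * real s powr ((k - 1) / 2)" if "s \<ge> 1" for s
  proof -
    have "w s * \<eta> s = \<eta> s powr (1 - k)"
      using eta_pos[OF that] unfolding w_def by (simp add: powr_diff)
    moreover have "- (1 - k) = k - 1" "- ((1 - k) / 2) = (k - 1) / 2"
      by (simp_all add: field_simps)
    ultimately show ?thesis using \<eta>[OF that, of "1 - k"] by (simp only:)
  qed
  have d: "0 \<le> d s" "d s \<le> R\<^sup>2" if "s \<ge> 1" for s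
    using xX[OF that] \<open>X \<subseteq> cball xstar R\<close>
    by (auto simp: d_def dist_norm norm_minus_commute intro!: power_mono)
  \<comment> \<open>The one-step inequality multiplied by
    \<open>w s / (2 * \<eta> s)\<close>.\<close>
  have gap: "w s * (f (x s) - f xstar)
      \<le> (w s / \<eta> s * (d s - d (Suc s)) + L\<^sup>2 * (w s * \<eta> s)) / 2" if "s \<ge> 1" for s
  proof -
    have "\<eta> s > 0" by (rule eta_pos[OF that])
    have "2 * \<eta> s * (f (x s) - f xstar) \<le> d s - d (Suc s) + (\<eta> s)\<^sup>2 * L\<^sup>2"
      unfolding d_def
      using \<open>xstar \<in> X\<close> \<open>X \<subseteq> D\<close> pstep(2,3)[OF that] \<open>\<eta> s > 0\<close> xX[OF that] \<open>convex X\<close> \<open>closed X\<close>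
        \<open>\<And>z h. z \<in> X \<Longrightarrow> h \<in> subdifferential D f z \<Longrightarrow> norm h \<le> L\<close>
      by (intro projected_subgradient_step[where h = "g s" and X = X and D = D]) auto
    then have "w s / (2 * \<eta> s) * (2 * \<eta> s * (f (x s) - f xstar))
        \<le> w s / (2 * \<eta> s) * (d s - d (Suc s) + (\<eta> s)\<^sup>2 * L\<^sup>2)"
      using \<open>\<eta> s > 0\<close> by (intro mult_left_mono) (auto simp: w_def)
    moreover have "w s / (2 * \<eta> s) * (2 * \<eta> s * (f (x s) - f xstar)) = w s * (f (x s) - f xstar)"
      using \<open>\<eta> s > 0\<close> by simp
    moreover have "w s / (2 * \<eta> s) * (d s - d (Suc s) + (\<eta> s)\<^sup>2 * L\<^sup>2)
        = (w s / \<eta> s * (d s - d (Suc s)) + L\<^sup>2 * (w s * \<eta> s)) / 2"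
      using \<open>\<eta> s > 0\<close> by (simp add: field_simps power2_eq_square)
    ultimately show ?thesis by simp
  qed
  have "f ((1 / (\<Sum>s=1..t. w s)) *\<^sub>R (\<Sum>s=1..t. w s *\<^sub>R x s)) - f xstar
      \<le> (N / (2 * c powr k * B)) / sqrt (real t)" if "t \<ge> 1" for t :: nat
  proof -
    let ?W = "\<Sum>s=1..t. w s"
    have "(\<Sum>s=1..t. w s / \<eta> s * (d s - d (Suc s))) \<le> w t / \<eta> t * R\<^sup>2"
    proof (rule sum_mult_diff_le)
      \<comment> \<open>The exponent \<open>(k + 1) / 2\<close> is positive because
        \<open>k > -1\<close>.\<close>
      show "w s / \<eta> s \<le> w (Suc s) / \<eta> (Suc s)" if "s \<ge> 1" for s
        using that \<open>k > -1\<close> \<open>c > 0\<close> by (simp add: w_div powr_mono2)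
    qed (use d that in \<open>auto simp: w_div\<close>)
    also have "\<dots> = c powr (k + 1) * R\<^sup>2 * real t powr ((k + 1) / 2)"
      using that by (simp add: w_div)
    finally have S1: "(\<Sum>s=1..t. w s / \<eta> s * (d s - d (Suc s))) \<le> \<dots>" .
    have "(\<Sum>s=1..t. w s * \<eta> s) = c powr (k - 1) * (\<Sum>s=1..t. real s powr ((k - 1) / 2))"
      by (simp add: w_mult sum_distrib_left)
    also have "\<dots> \<le> c powr (k - 1) * (A * real t powr ((k - 1) / 2 + 1))"
      unfolding A_def using \<open>k > -1\<close> by (intro mult_left_mono sum_powr_le) auto
    also have "(k - 1) / 2 + 1 = (k + 1) / 2" by (simp add: field_simps)
    finally have S2: "L\<^sup>2 * (\<Sum>s=1..t. w s * \<eta> s)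
        \<le> L\<^sup>2 * (c powr (k - 1) * (A * real t powr ((k + 1) / 2)))"
      by (intro mult_left_mono) auto
    have "(\<Sum>s=1..t. w s * (f (x s) - f xstar))
        \<le> (\<Sum>s=1..t. (w s / \<eta> s * (d s - d (Suc s)) + L\<^sup>2 * (w s * \<eta> s)) / 2)"
      by (intro sum_mono gap) auto
    also have "\<dots> = ((\<Sum>s=1..t. w s / \<eta> s * (d s - d (Suc s))) + L\<^sup>2 * (\<Sum>s=1..t. w s * \<eta> s)) / 2"
      by (simp only: sum.distrib sum_distrib_left flip: sum_divide_distrib)
    also have "\<dots> \<le> N / 2 * real t powr ((k + 1) / 2)"
      using S1 S2 by (simp add: N_def algebra_simps)
    finally have num: "(\<Sum>s=1..t. w s * (f (x s) - f xstar)) \<le> \<dots>" .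
    have "c powr k * (B * real t powr (k / 2 + 1))
        \<le> c powr k * (\<Sum>s=1..t. real s powr (k / 2))"
      unfolding B_def using \<open>k > -1\<close> by (intro mult_left_mono sum_powr_ge) auto
    also have "\<dots> = ?W" by (simp add: w sum_distrib_left)
    finally have den: "c powr k * (B * real t powr (k / 2 + 1)) \<le> ?W" .
    have pos: "0 < c powr k * (B * real t powr (k / 2 + 1))"
      using \<open>c > 0\<close> \<open>B > 0\<close> that by simp
    \<comment> \<open>Replacing the denominator by its smaller lower bound \<open>den\<close>
      enlarges the fraction only if the bound on the numerator is nonnegative.\<close>
    have "N \<ge> 0" by (simp add: N_def A_def)
    have "f ((1 / ?W) *\<^sub>R (\<Sum>s=1..t. w s *\<^sub>R x s)) - f xstar
        \<le> (\<Sum>s=1..t. w s * (f (x s) - f xstar)) / ?W"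
      using xX \<open>X \<subseteq> D\<close> pos den \<open>convex_on D f\<close>
      by (intro convex_on_weighted_mean_le[where D = D]) (auto simp: w_def)
    also have "\<dots> \<le> (N / 2 * real t powr ((k + 1) / 2)) / (c powr k * (B * real t powr (k / 2 + 1)))"
      using num den pos \<open>N \<ge> 0\<close> by (intro frac_le) auto
    also have "\<dots> = N / (2 * c powr k * B) * (real t powr ((k + 1) / 2) / real t powr (k / 2 + 1))"
      by simp
    \<comment> \<open>The exponents differ by 1/2 whatever \<open>k\<close> is, so the rate does not
      depend on \<open>k\<close>; only the constant does.\<close>
    also have "real t powr ((k + 1) / 2) / real t powr (k / 2 + 1) = real t powr - (1 / 2)"
      by (simp add: field_simps flip: powr_diff)
    also have "\<dots> = 1 / sqrt (real t)"
      by (simp add: powr_minus powr_half_sqrt inverse_eq_divide)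
    finally show ?thesis by simp
  qed
  then show ?thesis unfolding w_def by blast
qed

end
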